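(* Let $n$ be a positive integer. There exist $\varepsilon_0>0$, depending on $n$, and a constant $C>0$, depending on $n$ but independent of $\varepsilon$, such that for every $0<\varepsilon<\varepsilon_0$ the steady viscous Burgers equation $$u u_x-\varepsilon u_{xx}=f(x),\qquad x\in[0,2\pi],\qquad f(x)=-2\sin x-\sin x\cos x,$$ has a periodic solution $u^\varepsilon\in C^2([0,2\pi])$, i.e. one with $u^\varepsilon(0)=u^\varepsilon(2\pi)$, which satisfies $$\sup_{x\in[0,2\pi]}\left|u^\varepsilon(x)-u_0(x)-\varepsilon u_1(x)-\cdots-\varepsilon^n u_n(x)\right|\le C\varepsilon^{n+1}.$$
   Context: The functions $u_k$ ($k\ge 0$) are the smooth $2\pi$-periodic functions defined by $u_0(x)=-(2+\cos x)$ (so that $f=u_0u_0'$) and, recursively for $k\ge1$, $$u_0(x)u_k(x)=u_{k-1}'(x)-\frac12\sum_{\substack{i+j=k\\ i,j\ge1}}u_i(x)u_j(x)$$ (well defined since $u_0$ never vanishes; the sum is empty for $k=1$). The periodicity condition imposed on solutions of the Burgers equation is $u(0)=u(2\pi)$. *)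

theory Defs
  imports "HOL-Analysis.Analysis"
begin

definition burgers_f :: "real \<Rightarrow> real" where
  "burgers_f x = - 2 * sin x - sin x * cos x"

text \<open>The recursion is solved for the new coefficient by dividing by \<^term>\<open>- (2 + cos x)\<close>;
  the lemma \<open>burgers_coeff_rec\<close> below restores the undivided form. The totalised operator
  \<^const>\<open>deriv\<close> is harmless, since every coefficient is smooth (\<open>burgers_coeff_smooth\<close>).\<close>

fun burgers_coeff :: "nat \<Rightarrow> real \<Rightarrow> real" where
  "burgers_coeff 0 = (\<lambda>x. - (2 + cos x))"
| "burgers_coeff (Suc m) =
    (\<lambda>x. (deriv (burgers_coeff m) x
            - 1 / 2 * (\<Sum>i\<in>{1..m}. burgers_coeff i x * burgers_coeff (Suc m - i) x))
          / burgers_coeff 0 x)"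

text \<open>\<open>C\<^sup>2\<close> regularity on the closed interval is understood with one-sided derivatives at the
  end points; the values of \<open>u\<close> outside the interval play no role.\<close>

definition periodic_burgers_solution :: "real \<Rightarrow> (real \<Rightarrow> real) \<Rightarrow> bool" where
  "periodic_burgers_solution \<epsilon> u \<longleftrightarrow>
    (\<exists>u' u''.
       (\<forall>x\<in>{0..2*pi}. (u has_real_derivative u' x) (at x within {0..2*pi})) \<and>
       (\<forall>x\<in>{0..2*pi}. (u' has_real_derivative u'' x) (at x within {0..2*pi})) \<and>
       continuous_on {0..2*pi} u'' \<and>
       (\<forall>x\<in>{0..2*pi}. u x * u' x - \<epsilon> * u'' x = burgers_f x) \<and>
       u 0 = u (2*pi))"

lemma burgers_coeff_0_nonzero: "burgers_coeff 0 x \<noteq> 0"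
  using cos_ge_minus_one[of x] by (simp del: cos_ge_minus_one)

lemma burgers_f_eq: "burgers_f x = burgers_coeff 0 x * deriv (burgers_coeff 0) x"
proof -
  have "(burgers_coeff 0 has_real_derivative sin x) (at x)"
    by (auto intro!: derivative_eq_intros)
  from DERIV_imp_deriv[OF this] show ?thesis
    by (simp add: burgers_f_def algebra_simps)
qed

lemma burgers_coeff_rec:
  assumes "k \<ge> 1"
  shows "burgers_coeff 0 x * burgers_coeff k x =
    deriv (burgers_coeff (k - 1)) x
      - 1 / 2 * (\<Sum>(i, j) | i + j = k \<and> i \<ge> 1 \<and> j \<ge> 1. burgers_coeff i x * burgers_coeff j x)"
proof -
  obtain m where k: "k = Suc m" using assms by (cases k) auto
  have e: "Suc m - i = j" if "i + j = Suc m" for i j using that by simp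
  have "(\<Sum>(i, j) | i + j = k \<and> i \<ge> 1 \<and> j \<ge> 1. burgers_coeff i x * burgers_coeff j x)
      = (\<Sum>i\<in>{1..m}. burgers_coeff i x * burgers_coeff (Suc m - i) x)"
    by (rule sum.reindex_bij_witness[of _ "\<lambda>i. (i, Suc m - i)" fst]) (auto simp: k e)
  moreover have "burgers_coeff 0 x \<noteq> 0" by (rule burgers_coeff_0_nonzero)
  ultimately show ?thesis
    by (simp only: k burgers_coeff.simps(2) diff_Suc_1) (simp del: burgers_coeff.simps)
qed

inductive_set burgers_alg :: "(real \<Rightarrow> real) set" where
  const: "(\<lambda>x. c) \<in> burgers_alg"
| sin: "sin \<in> burgers_alg"
| cos: "cos \<in> burgers_alg"
| inv: "(\<lambda>x. inverse (2 + cos x)) \<in> burgers_alg"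
| add: "g \<in> burgers_alg \<Longrightarrow> h \<in> burgers_alg \<Longrightarrow> (\<lambda>x. g x + h x) \<in> burgers_alg"
| mult: "g \<in> burgers_alg \<Longrightarrow> h \<in> burgers_alg \<Longrightarrow> (\<lambda>x. g x * h x) \<in> burgers_alg"

lemma burgers_alg_deriv:
  "g \<in> burgers_alg \<Longrightarrow> \<exists>g'\<in>burgers_alg. \<forall>x. (g has_real_derivative g' x) (at x)"
proof (induction rule: burgers_alg.induct)
  case (const c)
  show ?case by (rule bexI[OF _ burgers_alg.const[of 0]]) (auto intro!: derivative_eq_intros)
next
  case sin
  show ?case by (rule bexI[OF _ burgers_alg.cos]) (auto intro!: derivative_eq_intros)
next
  case cos
  show ?case
    by (rule bexI[OF _ burgers_alg.mult[OF burgers_alg.const[of "-1"] burgers_alg.sin]])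
       (auto intro!: derivative_eq_intros)
next
  case inv
  have "2 + cos x \<noteq> 0" for x :: real using burgers_coeff_0_nonzero[of x] by simp
  then show ?case
    by (intro bexI[OF _ burgers_alg.mult[OF burgers_alg.sin
          burgers_alg.mult[OF burgers_alg.inv burgers_alg.inv]]])
       (auto intro!: derivative_eq_intros)
next
  case (add g h)
  then obtain g' h' where "g' \<in> burgers_alg" "h' \<in> burgers_alg"
    "\<forall>x. (g has_real_derivative g' x) (at x)" "\<forall>x. (h has_real_derivative h' x) (at x)" by blast
  then show ?case
    by (intro bexI[OF _ burgers_alg.add[of g' h']]) (auto intro!: DERIV_add)
next
  case (mult g h)
  then obtain g' h' where *: "g' \<in> burgers_alg" "h' \<in> burgers_alg"
    "\<forall>x. (g has_real_derivative g' x) (at x)" "\<forall>x. (h has_real_derivative h' x) (at x)" by blast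
  show ?case
    by (rule bexI[OF _ burgers_alg.add[OF burgers_alg.mult[OF *(1) mult.hyps(2)]
          burgers_alg.mult[OF *(2) mult.hyps(1)]]]) (use * in \<open>auto intro!: DERIV_mult\<close>)
qed

lemma burgers_alg_deriv_mem: "g \<in> burgers_alg \<Longrightarrow> deriv g \<in> burgers_alg"
proof -
  assume "g \<in> burgers_alg"
  then obtain g' where g': "g' \<in> burgers_alg" "\<forall>x. (g has_real_derivative g' x) (at x)"
    using burgers_alg_deriv by blast
  then have "deriv g = g'" by (auto intro: DERIV_imp_deriv)
  with g' show ?thesis by simp
qed

lemma burgers_alg_sum:
  "finite I \<Longrightarrow> (\<And>i. i \<in> I \<Longrightarrow> g i \<in> burgers_alg) \<Longrightarrow> (\<lambda>x. \<Sum>i\<in>I. g i x) \<in> burgers_alg"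
  by (induction I rule: finite_induct) (auto intro: burgers_alg.intros)

lemma burgers_coeff_mem: "burgers_coeff k \<in> burgers_alg"
proof (induction k rule: less_induct)
  case (less k)
  show ?case
  proof (cases k)
    case 0
    have "burgers_coeff 0 = (\<lambda>x. (-2) + (-1) * cos x)" by auto
    moreover have "(\<lambda>x. (-2) + (-1) * cos x) \<in> burgers_alg"
      by (intro burgers_alg.add burgers_alg.mult burgers_alg.const burgers_alg.cos)
    ultimately show ?thesis using 0 by simp
  next
    case (Suc m)
    have S: "(\<lambda>x. \<Sum>i\<in>{1..m}. burgers_coeff i x * burgers_coeff (Suc m - i) x) \<in> burgers_alg"
      by (rule burgers_alg_sum) (auto intro!: burgers_alg.mult less simp: Suc)
    have D: "deriv (burgers_coeff m) \<in> burgers_alg"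
      by (rule burgers_alg_deriv_mem) (auto intro: less simp: Suc)
    have "burgers_coeff k = (\<lambda>x. (deriv (burgers_coeff m) x
        + (- 1 / 2) * (\<Sum>i\<in>{1..m}. burgers_coeff i x * burgers_coeff (Suc m - i) x))
        * ((-1) * inverse (2 + cos x)))"
      unfolding Suc burgers_coeff.simps(2) unfolding burgers_coeff.simps(1)
        divide_inverse inverse_minus_eq by simp
    then show ?thesis
      by (simp only:) (intro burgers_alg.mult burgers_alg.add D S burgers_alg.const burgers_alg.inv)
  qed
qed

lemma burgers_coeff_smooth: "((deriv ^^ m) (burgers_coeff k)) field_differentiable (at x)"
proof -
  have "(deriv ^^ m) (burgers_coeff k) \<in> burgers_alg"
    by (induction m) (auto intro: burgers_coeff_mem burgers_alg_deriv_mem)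
  from burgers_alg_deriv[OF this] show ?thesis
    by (auto simp: field_differentiable_def)
qed

lemma burgers_coeff_periodic: "burgers_coeff k (x + 2 * pi) = burgers_coeff k x"
  using burgers_coeff_mem[of k] by (induction rule: burgers_alg.induct) auto

end

theory Submission
  imports Defs
begin

text \<open>Integrating the equation once, with integration constant \<open>0\<close>, gives the Riccati equation
  \<open>2 \<epsilon> u' = u\<^sup>2 - u\<^sub>0\<^sup>2\<close>, of which the partial sum \<open>v\<close> of the expansion is an approximate solution
  with residual \<open>O(\<epsilon>\<^sup>n\<^sup>+\<^sup>1)\<close>. Since \<open>u\<^sub>0 \<le> -1\<close>, the linearisation \<open>\<epsilon> w' - v w\<close> at \<open>v\<close> is
  invertible on periodic functions, with an inverse bounded in the supremum norm uniformly in
  \<open>\<epsilon>\<close> by the maximum principle. The correction \<open>w = u - v\<close> is then the fixed point of a contraction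
  of a ball whose radius is proportional to \<open>\<epsilon>\<^sup>n\<^sup>+\<^sup>1\<close>.\<close>

section \<open>Periodic solutions of first-order equations\<close>

text \<open>Variation of constants with the integrating factor \<open>exp (A x)\<close>. As
  \<open>a\<close> is bounded below by \<open>m > 0\<close>, \<open>A L\<close> is positive and the
  initial value can be chosen so that the solution closes up after one period.\<close>

lemma periodic_linear_ode_exists:
  fixes a g :: "real \<Rightarrow> real"
  assumes L: "L > 0" and a: "continuous_on {0..L} a" and g: "continuous_on {0..L} g"
    and m: "m > 0" "\<And>x. x \<in> {0..L} \<Longrightarrow> m \<le> a x"
  shows "\<exists>w. w 0 = w L \<and>
    (\<forall>x\<in>{0..L}. (w has_real_derivative g x - a x * w x) (at x within {0..L}))"
proof -
  define A where "A x = integral {0..x} a" for x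
  have dA: "(A has_real_derivative a x) (at x within {0..L})" if "x \<in> {0..L}" for x
    unfolding A_def by (rule integral_has_real_derivative[OF a that])
  have cA: "continuous_on {0..L} A"
    by (rule DERIV_continuous_on[OF dA])
  define I where "I x = integral {0..x} (\<lambda>s. exp (A s) * g s)" for x
  have cI: "continuous_on {0..L} (\<lambda>s. exp (A s) * g s)"
    by (intro continuous_intros cA g)
  have dI: "(I has_real_derivative exp (A x) * g x) (at x within {0..L})" if "x \<in> {0..L}" for x
    unfolding I_def by (rule integral_has_real_derivative[OF cI that])
  have "m * L \<le> A L"
    using integral_le[of "\<lambda>x. m" "{0..L}" a] L m(2) integrable_continuous_real[OF a]
    by (simp add: A_def mult.commute integrable_const_ivl)
  moreover have "0 < m * L" using m(1) L by simp
  ultimately have AL: "exp (A L) > 1" by simp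
  \<comment> \<open>\<open>\<kappa>\<close> is the value at \<open>0\<close>; it solves the closing
    condition \<open>exp (- A L) * (\<kappa> + I L) = \<kappa>\<close>.\<close>
  define \<kappa> where "\<kappa> = I L / (exp (A L) - 1)"
  define w where "w x = exp (- A x) * (\<kappa> + I x)" for x
  have "w 0 = \<kappa>" by (simp add: w_def A_def I_def)
  moreover have "w L = \<kappa>"
    using AL by (simp add: w_def \<kappa>_def exp_minus field_simps)
  moreover have "(w has_real_derivative g x - a x * w x) (at x within {0..L})" if "x \<in> {0..L}" for x
  proof -
    have "(w has_real_derivative
        (exp (- A x) * (- a x)) * (\<kappa> + I x) + (exp (A x) * g x) * exp (- A x)) (at x within {0..L})"
      unfolding w_def by (auto intro!: derivative_eq_intros dA dI that)
    also have "(exp (- A x) * (- a x)) * (\<kappa> + I x) + (exp (A x) * g x) * exp (- A x) =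
        g x - a x * w x"
      by (simp add: w_def exp_minus field_simps)
    finally show ?thesis .
  qed
  ultimately show ?thesis by (intro exI[of _ w]) auto
qed

text \<open>At a maximum point reached from the left the derivative is nonnegative, so a w \<le> g
  \<le> G there, and m w \<le> a w if w is positive. The bound depends only on the ratio
  \<open>G / m\<close>, from which \<epsilon> cancels in the application.\<close>

lemma periodic_max_principle:
  fixes w :: "real \<Rightarrow> real"
  assumes L: "L > 0" and per: "w 0 = w L" and m: "m > 0" "\<And>x. x \<in> {0..L} \<Longrightarrow> m \<le> a x"
    and w: "\<And>x. x \<in> {0..L} \<Longrightarrow> (w has_real_derivative g x - a x * w x) (at x within {0..L})"
    and g: "\<And>x. x \<in> {0..L} \<Longrightarrow> g x \<le> G" and G: "G \<ge> 0" and x: "x \<in> {0..L}"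
  shows "w x \<le> G / m"
proof -
  have "continuous_on {0..L} w" by (rule DERIV_continuous_on[OF w])
  then obtain z where z: "z \<in> {0..L}" "\<And>y. y \<in> {0..L} \<Longrightarrow> w y \<le> w z"
    using continuous_attains_sup[of "{0..L}" w] L by auto
  \<comment> \<open>By periodicity the maximum is attained away from \<open>0\<close>, so a left derivative is available.\<close>
  define t where "t = (if z = 0 then L else z)"
  have t: "0 < t" "t \<le> L" "w t = w z" using z(1) L per by (auto simp: t_def)
  have "0 \<le> g t - a t * w t"
  proof (rule ccontr)
    assume "\<not> ?thesis"
    then have "g t - a t * w t < 0" by simp
    from has_real_derivative_neg_dec_left[OF w this] t
    obtain d where d: "d > 0" "\<And>h. h > 0 \<Longrightarrow> t - h \<in> {0..L} \<Longrightarrow> h < d \<Longrightarrow> w t < w (t - h)"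
      by auto
    have "t - min t (d / 2) \<in> {0..L}" using t d(1) by auto
    moreover have "min t (d / 2) > 0" "min t (d / 2) < d" using t d(1) by auto
    ultimately show False using d(2) z(2) t(3) by fastforce
  qed
  then have *: "a t * w t \<le> G" using g[of t] t by auto
  have "w t \<le> G / m"
  proof (cases "w t \<le> 0")
    case True
    moreover have "0 \<le> G / m" using G m(1) by simp
    ultimately show ?thesis by linarith
  next
    case False
    then have "m * w t \<le> a t * w t" using m(2)[of t] t by (intro mult_right_mono) auto
    then show ?thesis using * m(1) by (simp add: field_simps)
  qed
  then show ?thesis using z(2)[OF x] t(3) by simp
qed

text \<open>The one-sided bound applies to \<open>w\<close> and to \<open>- w\<close>, which solves
  the equation with \<open>- g\<close>. By linearity it also controls the difference of two
  solutions, which is how the contraction estimate arises.\<close>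

corollary periodic_max_principle_abs:
  fixes w :: "real \<Rightarrow> real"
  assumes L: "L > 0" and per: "w 0 = w L" and m: "m > 0" "\<And>x. x \<in> {0..L} \<Longrightarrow> m \<le> a x"
    and w: "\<And>x. x \<in> {0..L} \<Longrightarrow> (w has_real_derivative g x - a x * w x) (at x within {0..L})"
    and g: "\<And>x. x \<in> {0..L} \<Longrightarrow> \<bar>g x\<bar> \<le> G" and x: "x \<in> {0..L}"
  shows "\<bar>w x\<bar> \<le> G / m"
proof -
  have G: "G \<ge> 0" using g[OF x] by linarith
  have "w x \<le> G / m"
    by (rule periodic_max_principle[where a = a and g = g, OF L per m w _ G x]) (use g in fastforce)+
  moreover have "- w x \<le> G / m"
  proof (rule periodic_max_principle[where w = "\<lambda>x. - w x" and a = a and g = "\<lambda>x. - g x",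
        OF L _ m _ _ G x])
    fix y assume y: "y \<in> {0..L}"
    show "((\<lambda>x. - w x) has_real_derivative - g y - a y * - w y) (at y within {0..L})"
      using DERIV_minus[OF w[OF y]] by (simp add: algebra_simps)
    show "- g y \<le> G" using g[OF y] by linarith
  qed (use per in auto)
  ultimately show ?thesis by linarith
qed

lemma periodic_riccati_exists:
  fixes a r :: "real \<Rightarrow> real"
  assumes L: "L > 0" and a: "continuous_on {0..L} a" and r: "continuous_on {0..L} r"
    and m: "m > 0" "\<And>x. x \<in> {0..L} \<Longrightarrow> m \<le> a x"
    and c: "c \<ge> 0" and \<delta>: "\<delta> \<ge> 0" "c * \<delta> \<le> m / 4"
    and r_le: "\<And>x. x \<in> {0..L} \<Longrightarrow> \<bar>r x\<bar> \<le> m * \<delta> / 2"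
  shows "\<exists>w. w 0 = w L \<and> (\<forall>x\<in>{0..L}. \<bar>w x\<bar> \<le> \<delta>) \<and>
    (\<forall>x\<in>{0..L}. (w has_real_derivative r x + c * (w x)\<^sup>2 - a x * w x) (at x within {0..L}))"
proof -
  define N where "N W x = r x + c * (apply_bcontfun W x)\<^sup>2" for W x
  have N: "continuous_on {0..L} (N W)" for W
    unfolding N_def by (intro continuous_intros r continuous_on_apply_bcontfun)
  have "\<exists>w. w 0 = w L \<and>
      (\<forall>x\<in>{0..L}. (w has_real_derivative N W x - a x * w x) (at x within {0..L}))" for W
    by (rule periodic_linear_ode_exists[OF L a N m])
  then obtain T where T_per: "T W 0 = T W L"
    and T: "x \<in> {0..L} \<Longrightarrow> (T W has_real_derivative N W x - a x * T W x) (at x within {0..L})"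
    for W x by metis
  \<comment> \<open>Functions on \<open>{0..L}\<close> are extended by constants, so as to live in a complete space.\<close>
  define cl where "cl x = max 0 (min L x)" for x
  have cl: "cl x \<in> {0..L}" for x using L by (auto simp: cl_def)
  have cl_id: "cl x = x" if "x \<in> {0..L}" for x using that by (auto simp: cl_def)
  have cT: "continuous_on {0..L} (T W)" for W by (rule DERIV_continuous_on[OF T])
  have "(\<lambda>x. T W (cl x)) \<in> bcontfun" for W
    unfolding bcontfun_def
  proof (intro CollectI conjI)
    have "continuous_on UNIV cl" unfolding cl_def by (intro continuous_intros)
    then show "continuous_on UNIV (\<lambda>x. T W (cl x))"
      by (rule continuous_on_compose2[OF cT]) (use cl in auto)
    have "bounded (T W ` {0..L})"
      by (intro compact_imp_bounded compact_continuous_image cT) auto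
    then show "bounded (range (\<lambda>x. T W (cl x)))"
      by (rule bounded_subset) (use cl in auto)
  qed
  then have T_cl: "apply_bcontfun (Bcontfun (\<lambda>x. T W (cl x))) x = T W (cl x)" for W x
    by (simp add: Bcontfun_inverse)
  define S :: "(real \<Rightarrow>\<^sub>C real) set" where "S = cball 0 \<delta>"
  have S: "\<bar>apply_bcontfun W x\<bar> \<le> \<delta>" if "W \<in> S" for W x
    using norm_bounded[of W x] that by (simp add: S_def)
  have T_le: "\<bar>T W x\<bar> \<le> \<delta>" if W: "W \<in> S" and x: "x \<in> {0..L}" for W x
  proof -
    have "\<bar>N W x\<bar> \<le> m * \<delta>" if "x \<in> {0..L}" for x
    proof -
      have "c * (apply_bcontfun W x)\<^sup>2 \<le> c * \<delta>\<^sup>2"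
        using S[OF W, of x] c by (intro mult_left_mono) (auto simp: abs_le_square_iff[symmetric] \<delta>)
      also have "\<dots> = (c * \<delta>) * \<delta>" by (simp add: power2_eq_square)
      also have "\<dots> \<le> (m / 4) * \<delta>" by (rule mult_right_mono) (use \<delta> in auto)
      finally have "c * (apply_bcontfun W x)\<^sup>2 \<le> (m / 4) * \<delta>" .
      moreover have "0 \<le> c * (apply_bcontfun W x)\<^sup>2" using c by simp
      moreover have "0 \<le> m * \<delta>" using m \<delta> by simp
      ultimately show ?thesis using r_le[OF that] by (simp add: N_def)
    qed
    from periodic_max_principle_abs[where w = "T W" and a = a, OF L T_per m T this x]
    show ?thesis using m by simp
  qed
  have T_dist: "\<bar>T V x - T W x\<bar> \<le> 1 / 2 * dist V W"
    if V: "V \<in> S" and W: "W \<in> S" and x: "x \<in> {0..L}" for V W x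
  proof -
    have "\<bar>N V x - N W x\<bar> \<le> m / 2 * dist V W" for x
    proof -
      let ?V = "apply_bcontfun V x" and ?W = "apply_bcontfun W x"
      have "\<bar>N V x - N W x\<bar> = c * \<bar>?V + ?W\<bar> * \<bar>?V - ?W\<bar>"
      proof -
        have "N V x - N W x = c * ((?V + ?W) * (?V - ?W))"
          by (simp add: N_def power2_eq_square algebra_simps)
        then show ?thesis using c by (simp add: abs_mult)
      qed
      also have "\<dots> \<le> c * (2 * \<delta>) * dist V W"
        using S[OF V, of x] S[OF W, of x] c \<delta> dist_bounded[of V x W]
        by (intro mult_mono) (auto simp: dist_real_def)
      also have "\<dots> \<le> m / 2 * dist V W"
        using \<delta> by (intro mult_right_mono) auto
      finally show ?thesis .
    qed
    then have "\<bar>T V x - T W x\<bar> \<le> (m / 2 * dist V W) / m"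
    proof (intro periodic_max_principle_abs[where w = "\<lambda>x. T V x - T W x" and a = a
          and g = "\<lambda>x. N V x - N W x", OF L _ m _ _ x])
      fix y assume y: "y \<in> {0..L}"
      show "((\<lambda>x. T V x - T W x) has_real_derivative
          N V y - N W y - a y * (T V y - T W y)) (at y within {0..L})"
        using DERIV_diff[OF T[OF y, of V] T[OF y, of W]] by (simp add: algebra_simps)
    qed (use T_per in auto)
    then show ?thesis using m by simp
  qed
  have "\<exists>!W\<in>S. Bcontfun (\<lambda>x. T W (cl x)) = W"
  proof (rule Banach_fix[where c = "1 / 2"])
    show "complete S" unfolding S_def by (simp add: complete_eq_closed)
    show "S \<noteq> {}" using \<delta> by (auto simp: S_def)
    show "(\<lambda>W. Bcontfun (\<lambda>x. T W (cl x))) ` S \<subseteq> S"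
      by (auto simp: S_def T_cl intro!: norm_bound T_le[unfolded S_def] cl)
    show "dist (Bcontfun (\<lambda>x. T V (cl x))) (Bcontfun (\<lambda>x. T W (cl x))) \<le> 1 / 2 * dist V W"
      if "V \<in> S" "W \<in> S" for V W
      by (rule dist_bound) (use that T_dist cl in \<open>auto simp: T_cl dist_real_def\<close>)
  qed auto
  then obtain W where W: "W \<in> S" "Bcontfun (\<lambda>x. T W (cl x)) = W" by auto
  have TW: "apply_bcontfun W x = T W x" if "x \<in> {0..L}" for x
    using T_cl[of W x] W(2) cl_id[OF that] by simp
  show ?thesis
    using T_per[of W] T[of _ W] T_le[OF W(1)] TW by (intro exI[of _ "T W"]) (auto simp: N_def)
qed

section \<open>The truncated expansion\<close>

text \<open>The end terms i = 0 and i = m + 1 both equal u_0 u_(m+1), and the recursion rewrites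
  their sum. This is the \<epsilon>^(m+1) coefficient of the formal identity u^2 - u_0^2 = 2
  \<epsilon> u'.\<close>

lemma burgers_coeff_convolution:
  "(\<Sum>i\<le>Suc m. burgers_coeff i x * burgers_coeff (Suc m - i) x) = 2 * deriv (burgers_coeff m) x"
proof -
  have "{..Suc m} = insert 0 (insert (Suc m) {1..m})" by auto
  then have "(\<Sum>i\<le>Suc m. burgers_coeff i x * burgers_coeff (Suc m - i) x) =
      2 * (burgers_coeff 0 x * burgers_coeff (Suc m) x) +
      (\<Sum>i\<in>{1..m}. burgers_coeff i x * burgers_coeff (Suc m - i) x)"
    by (simp del: burgers_coeff.simps)
  moreover have "burgers_coeff 0 x * burgers_coeff (Suc m) x = deriv (burgers_coeff m) x
      - 1 / 2 * (\<Sum>i\<in>{1..m}. burgers_coeff i x * burgers_coeff (Suc m - i) x)"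
    using burgers_coeff_0_nonzero[of x]
    by (simp only: burgers_coeff.simps(2)) (simp del: burgers_coeff.simps)
  ultimately show ?thesis by simp
qed

lemma burgers_coeff_has_deriv:
  "(burgers_coeff k has_real_derivative deriv (burgers_coeff k) x) (at x)"
  using burgers_coeff_smooth[of 0 k x] by (simp add: DERIV_deriv_iff_field_differentiable)

text \<open>2 + cos x \<ge> 1 bounds the one generator that involves division; the other generators
  are bounded, and bounds pass to sums and products.\<close>

lemma burgers_alg_bounded:
  assumes "g \<in> burgers_alg" shows "\<exists>B. \<forall>x. \<bar>g x\<bar> \<le> B"
  using assms
proof (induction rule: burgers_alg.induct)
  case inv
  have "\<bar>inverse (2 + cos x)\<bar> \<le> 1" for x :: real
    using cos_ge_minus_one[of x] by (simp add: inverse_le_1_iff del: cos_ge_minus_one)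
  then show ?case by blast
next
  case (add g h)
  then obtain B C where "\<And>x. \<bar>g x\<bar> \<le> B" "\<And>x. \<bar>h x\<bar> \<le> C" by blast
  then have "\<bar>g x + h x\<bar> \<le> B + C" for x
    using abs_triangle_ineq[of "g x" "h x"] add_mono order_trans by blast
  then show ?case by blast
next
  case (mult g h)
  then obtain B C where BC: "\<And>x. \<bar>g x\<bar> \<le> B" "\<And>x. \<bar>h x\<bar> \<le> C" by blast
  then have "\<bar>g x * h x\<bar> \<le> B * C" for x
    unfolding abs_mult using order_trans[OF abs_ge_zero BC(1)] by (intro mult_mono) auto
  then show ?case by blast
qed (auto intro: exI[of _ 1])

definition burgers_partial_sum :: "nat \<Rightarrow> real \<Rightarrow> real \<Rightarrow> real" where
  "burgers_partial_sum n \<epsilon> x = (\<Sum>k\<le>n. \<epsilon> ^ k * burgers_coeff k x)"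

definition burgers_partial_sum_deriv :: "nat \<Rightarrow> real \<Rightarrow> real \<Rightarrow> real" where
  "burgers_partial_sum_deriv n \<epsilon> x = (\<Sum>k\<le>n. \<epsilon> ^ k * deriv (burgers_coeff k) x)"

lemma burgers_partial_sum_has_deriv:
  "(burgers_partial_sum n \<epsilon> has_real_derivative burgers_partial_sum_deriv n \<epsilon> x) (at x)"
  unfolding burgers_partial_sum_def burgers_partial_sum_deriv_def
  by (intro DERIV_sum DERIV_cmult burgers_coeff_has_deriv)

lemma continuous_on_burgers_partial_sum_deriv: "continuous_on A (burgers_partial_sum_deriv n \<epsilon>)"
proof -
  have "(deriv (burgers_coeff k) has_real_derivative deriv (deriv (burgers_coeff k)) x) (at x)"
    for k x
    using burgers_coeff_smooth[of 1 k x] by (simp add: DERIV_deriv_iff_field_differentiable)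
  then have "continuous_on A (deriv (burgers_coeff k))" for k
    by (intro DERIV_continuous_on) (auto intro: has_field_derivative_at_within)
  then show ?thesis
    unfolding burgers_partial_sum_deriv_def by (intro continuous_intros)
qed

text \<open>The defect of the partial sum in 2 \<epsilon> u' = u^2 - u_0^2, left undivided by 2
  \<epsilon> so that it is a polynomial in \<epsilon>.\<close>

definition burgers_residual :: "nat \<Rightarrow> real \<Rightarrow> real \<Rightarrow> real" where
  "burgers_residual n \<epsilon> x = (burgers_partial_sum n \<epsilon> x)\<^sup>2 - (burgers_coeff 0 x)\<^sup>2
     - 2 * \<epsilon> * burgers_partial_sum_deriv n \<epsilon> x"

text \<open>In the square of the partial sum the pairs with i + j \<le> n form full convolutions,
  which cancel u_0^2 and the derivatives of u_0, ..., u_(n-1). Only the pairs with i + j > n and the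
  derivative of u_n survive, all carrying at least n + 1 factors \<epsilon>.\<close>

lemma burgers_residual_eq:
  "burgers_residual n \<epsilon> x =
    (\<Sum>(i, j) | i \<le> n \<and> j \<le> n \<and> n < i + j. \<epsilon> ^ (i + j) * (burgers_coeff i x * burgers_coeff j x))
    - 2 * \<epsilon> ^ Suc n * deriv (burgers_coeff n) x"
proof -
  define F where "F = (\<lambda>(i, j). \<epsilon> ^ (i + j) * (burgers_coeff i x * burgers_coeff j x))"
  define H where "H = {(i, j). i \<le> n \<and> j \<le> n \<and> n < i + j}"
  have fin: "finite H" by (rule finite_subset[of _ "{..n} \<times> {..n}"]) (auto simp: H_def)
  have finT: "finite {(i, j). i + j \<le> n}"
    by (rule finite_subset[of _ "{..n} \<times> {..n}"]) auto
  have "(burgers_partial_sum n \<epsilon> x)\<^sup>2 = sum F ({..n} \<times> {..n})"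
    unfolding burgers_partial_sum_def power2_eq_square sum_product sum.cartesian_product F_def
    by (rule sum.cong) (auto simp: power_add mult_ac simp del: burgers_coeff.simps)
  also have "{..n} \<times> {..n} = {(i, j). i + j \<le> n} \<union> H" by (auto simp: H_def)
  also have "sum F \<dots> = sum F {(i, j). i + j \<le> n} + sum F H"
    by (rule sum.union_disjoint) (use fin finT in \<open>auto simp: H_def\<close>)
  also have "sum F {(i, j). i + j \<le> n} = (\<Sum>k\<le>n. \<Sum>i\<le>k. F (i, k - i))"
    using sum.triangle_reindex_eq[of "\<lambda>i j. F (i, j)" n] by simp
  also have "\<dots> = (\<Sum>k\<le>n. \<epsilon> ^ k * (\<Sum>i\<le>k. burgers_coeff i x * burgers_coeff (k - i) x))"
    by (simp add: F_def sum_distrib_left del: burgers_coeff.simps)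
  \<comment> \<open>Order 0 contributes u_0^2; the other orders are shifted by one to match the
    convolution identity.\<close>
  also have "\<dots> = (burgers_coeff 0 x)\<^sup>2
      + (\<Sum>k<n. \<epsilon> ^ Suc k * (\<Sum>i\<le>Suc k. burgers_coeff i x * burgers_coeff (Suc k - i) x))"
    by (subst sum.atMost_shift) (simp add: power2_eq_square del: burgers_coeff.simps sum.atMost_Suc)
  also have "\<dots> = (burgers_coeff 0 x)\<^sup>2 + 2 * \<epsilon> * (\<Sum>k<n. \<epsilon> ^ k * deriv (burgers_coeff k) x)"
    by (simp only: burgers_coeff_convolution)
       (simp add: sum_distrib_left mult_ac del: burgers_coeff.simps)
  \<comment> \<open>Order k + 1 of the square pairs with the derivative of u_k, so orders up to n
    use the derivatives for k < n; the one for k = n is left over.\<close>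
  also have "2 * \<epsilon> * (\<Sum>k<n. \<epsilon> ^ k * deriv (burgers_coeff k) x) =
      2 * \<epsilon> * burgers_partial_sum_deriv n \<epsilon> x - 2 * \<epsilon> ^ Suc n * deriv (burgers_coeff n) x"
    unfolding burgers_partial_sum_deriv_def lessThan_Suc_atMost[symmetric]
    by (simp add: algebra_simps del: burgers_coeff.simps)
  finally show ?thesis by (simp add: burgers_residual_def F_def H_def del: burgers_coeff.simps)
qed

lemma burgers_coeffs_bounded:
  "\<exists>B\<ge>1. \<forall>k\<le>n. \<forall>x. \<bar>burgers_coeff k x\<bar> \<le> B \<and> \<bar>deriv (burgers_coeff k) x\<bar> \<le> B"
proof -
  have "\<exists>B. \<forall>x. \<bar>burgers_coeff k x\<bar> \<le> B \<and> \<bar>deriv (burgers_coeff k) x\<bar> \<le> B" for k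
  proof -
    obtain B C where "\<And>x. \<bar>burgers_coeff k x\<bar> \<le> B" "\<And>x. \<bar>deriv (burgers_coeff k) x\<bar> \<le> C"
      using burgers_alg_bounded[OF burgers_coeff_mem[of k]]
        burgers_alg_bounded[OF burgers_alg_deriv_mem[OF burgers_coeff_mem[of k]]] by blast
    then show ?thesis
      by (intro exI[of _ "max B C"]) (auto simp: le_max_iff_disj simp del: burgers_coeff.simps)
  qed
  then obtain B where B: "\<bar>burgers_coeff k x\<bar> \<le> B k" "\<bar>deriv (burgers_coeff k) x\<bar> \<le> B k" for k x
    by metis
  define M where "M = Max (insert 1 (B ` {..n}))"
  have "B k \<le> M" if "k \<le> n" for k
    unfolding M_def by (rule Max_ge) (use that in auto)
  then have "\<bar>burgers_coeff k x\<bar> \<le> M \<and> \<bar>deriv (burgers_coeff k) x\<bar> \<le> M" if "k \<le> n" for k x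
    using B order_trans that by blast
  moreover have "M \<ge> 1" unfolding M_def by (rule Max_ge) auto
  ultimately show ?thesis by blast
qed

text \<open>For \<epsilon> < 1 every power \<epsilon>^(i+j) with i + j > n is at most
  \<epsilon>^(n+1), and the number of surviving pairs depends only on n.\<close>

lemma burgers_residual_bound:
  "\<exists>K>0. \<forall>\<epsilon> x. 0 < \<epsilon> \<and> \<epsilon> < 1 \<longrightarrow> \<bar>burgers_residual n \<epsilon> x\<bar> \<le> K * \<epsilon> ^ (n + 1)"
proof -
  obtain B where B1: "B \<ge> 1"
    and B: "\<And>k x. k \<le> n \<Longrightarrow> \<bar>burgers_coeff k x\<bar> \<le> B"
      "\<And>k x. k \<le> n \<Longrightarrow> \<bar>deriv (burgers_coeff k) x\<bar> \<le> B"
    using burgers_coeffs_bounded[of n] by blast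
  define H where "H = {(i, j). i \<le> n \<and> j \<le> n \<and> n < i + j}"
  \<comment> \<open>One B^2 for each surviving pair, and 2 B for the leftover derivative.\<close>
  define K where "K = real (card H) * B\<^sup>2 + 2 * B"
  have "\<bar>burgers_residual n \<epsilon> x\<bar> \<le> K * \<epsilon> ^ Suc n" if e: "0 < \<epsilon>" "\<epsilon> < 1" for \<epsilon> x
  proof -
    have "\<bar>\<Sum>(i, j)\<in>H. \<epsilon> ^ (i + j) * (burgers_coeff i x * burgers_coeff j x)\<bar>
        \<le> (\<Sum>p\<in>H. \<epsilon> ^ Suc n * B\<^sup>2)"
    proof (rule sum_abs[THEN order_trans], rule sum_mono, clarify)
      fix i j assume "(i, j) \<in> H"
      then have ij: "i \<le> n" "j \<le> n" "Suc n \<le> i + j" by (auto simp: H_def)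
      have "\<bar>burgers_coeff i x * burgers_coeff j x\<bar> \<le> B\<^sup>2"
        unfolding abs_mult power2_eq_square by (intro mult_mono B ij) (use B1 in auto)
      then show "\<bar>\<epsilon> ^ (i + j) * (burgers_coeff i x * burgers_coeff j x)\<bar> \<le> \<epsilon> ^ Suc n * B\<^sup>2"
        unfolding abs_mult[of "\<epsilon> ^ (i + j)"] power_abs
        using e power_decreasing[OF ij(3), of \<epsilon>] by (intro mult_mono) auto
    qed
    moreover have "\<bar>2 * \<epsilon> ^ Suc n * deriv (burgers_coeff n) x\<bar> \<le> 2 * \<epsilon> ^ Suc n * B"
      unfolding abs_mult using e B(2)[of n x] by (intro mult_mono) auto
    ultimately show ?thesis
      unfolding burgers_residual_eq H_def[symmetric] K_def
      by (simp add: algebra_simps del: burgers_coeff.simps)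
  qed
  moreover have "K > 0" using B1 by (auto simp: K_def intro!: add_nonneg_pos)
  ultimately show ?thesis by (intro exI[of _ K]) auto
qed

text \<open>u_0 \<le> -1, and for small \<epsilon> the remaining terms add up to less than 1/2. The
  negative upper bound provides the damping in the equation for the correction.\<close>

lemma burgers_partial_sum_le:
  "\<exists>\<epsilon>\<^sub>1>0. \<forall>\<epsilon> x. 0 < \<epsilon> \<and> \<epsilon> < \<epsilon>\<^sub>1 \<longrightarrow> burgers_partial_sum n \<epsilon> x \<le> - 1 / 2"
proof -
  obtain B where B1: "B \<ge> 1" and B: "\<And>k x. k \<le> n \<Longrightarrow> \<bar>burgers_coeff k x\<bar> \<le> B"
    using burgers_coeffs_bounded[of n] by blast
  \<comment> \<open>Chosen so that \<epsilon> B (n + 1) < 1/2; as 2 B (n + 1) \<ge> 1, it also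
    forces \<epsilon> < 1, whence \<epsilon>^(k+1) \<le> \<epsilon>.\<close>
  define \<epsilon>\<^sub>1 where "\<epsilon>\<^sub>1 = 1 / (2 * B * (real n + 1))"
  have nB: "2 * B * (real n + 1) \<ge> 1"
  proof -
    have "1 * 1 \<le> (2 * B) * (real n + 1)" using B1 by (intro mult_mono) auto
    then show ?thesis by simp
  qed
  have "burgers_partial_sum n \<epsilon> x \<le> - 1 / 2" if e: "0 < \<epsilon>" "\<epsilon> < \<epsilon>\<^sub>1" for \<epsilon> x
  proof -
    have e1: "\<epsilon> * (2 * B * (real n + 1)) < 1"
      using e nB by (simp add: \<epsilon>\<^sub>1_def less_divide_eq)
    have "\<epsilon>\<^sub>1 \<le> 1" using nB by (simp add: \<epsilon>\<^sub>1_def)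
    then have "\<epsilon> < 1" using e by linarith
    have "(\<Sum>k<n. \<epsilon> ^ Suc k * burgers_coeff (Suc k) x) \<le> (\<Sum>k<n. \<epsilon> * B)"
    proof (rule sum_mono)
      fix k assume "k \<in> {..<n}"
      then have "\<bar>burgers_coeff (Suc k) x\<bar> \<le> B" by (intro B) auto
      moreover have "\<epsilon> ^ Suc k \<le> \<epsilon>"
        using e \<open>\<epsilon> < 1\<close> power_decreasing[of 1 "Suc k" \<epsilon>] by simp
      ultimately have "\<bar>\<epsilon> ^ Suc k\<bar> * \<bar>burgers_coeff (Suc k) x\<bar> \<le> \<epsilon> * B"
        using e by (intro mult_mono) auto
      then show "\<epsilon> ^ Suc k * burgers_coeff (Suc k) x \<le> \<epsilon> * B"
        unfolding abs_mult[symmetric] by linarith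
    qed
    also have "\<dots> \<le> \<epsilon> * B * (real n + 1)" using e B1 by (simp add: algebra_simps)
    also have "\<dots> < 1 / 2" using e1 by simp
    finally have "(\<Sum>k<n. \<epsilon> ^ Suc k * burgers_coeff (Suc k) x) < 1 / 2" .
    moreover have "burgers_coeff 0 x \<le> - 1"
      using cos_ge_minus_one[of x] by (simp del: cos_ge_minus_one)
    moreover have "burgers_partial_sum n \<epsilon> x =
        burgers_coeff 0 x + (\<Sum>k<n. \<epsilon> ^ Suc k * burgers_coeff (Suc k) x)"
      unfolding burgers_partial_sum_def by (subst sum.atMost_shift) (simp del: burgers_coeff.simps)
    ultimately show ?thesis by linarith
  qed
  moreover have "\<epsilon>\<^sub>1 > 0" using B1 by (simp add: \<epsilon>\<^sub>1_def)
  ultimately show ?thesis by blast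
qed

text \<open>Differentiating 2 \<epsilon> u' = u^2 - u_0^2 gives \<epsilon> u'' = u u' - u_0 u_0',
  and u_0 u_0' is the forcing f. The first-order equation itself supplies the second derivative and
  its continuity.\<close>

lemma periodic_burgers_solutionI:
  assumes e: "\<epsilon> \<noteq> 0" and per: "u 0 = u (2 * pi)"
    and u: "\<And>x. x \<in> {0..2*pi} \<Longrightarrow> (u has_real_derivative
      ((u x)\<^sup>2 - (burgers_coeff 0 x)\<^sup>2) / (2 * \<epsilon>)) (at x within {0..2*pi})"
  shows "periodic_burgers_solution \<epsilon> u"
proof -
  define u' where "u' x = ((u x)\<^sup>2 - (burgers_coeff 0 x)\<^sup>2) / (2 * \<epsilon>)" for x
  \<comment> \<open>\<open>u''\<close> is read off from the Burgers equation, which then holds by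
    definition; that it is the derivative of \<open>u'\<close> remains to be shown.\<close>
  define u'' where "u'' x = (u x * u' x - burgers_f x) / \<epsilon>" for x
  have du: "(u has_real_derivative u' x) (at x within {0..2*pi})" if "x \<in> {0..2*pi}" for x
    using u[OF that] by (simp add: u'_def)
  have d0: "(burgers_coeff 0 has_real_derivative deriv (burgers_coeff 0) x) (at x within {0..2*pi})"
    for x by (rule has_field_derivative_at_within[OF burgers_coeff_has_deriv])
  have du': "(u' has_real_derivative u'' x) (at x within {0..2*pi})" if "x \<in> {0..2*pi}" for x
  proof -
    have "((\<lambda>x. ((u x)\<^sup>2 - (burgers_coeff 0 x)\<^sup>2) / (2 * \<epsilon>)) has_real_derivative (2 * u x * u' x -
        2 * burgers_coeff 0 x * deriv (burgers_coeff 0) x) / (2 * \<epsilon>)) (at x within {0..2*pi})"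
      by (rule derivative_eq_intros du[OF that] d0 refl)+
        (use e in \<open>simp_all add: divide_simps del: burgers_coeff.simps\<close>)
    then have "(u' has_real_derivative (2 * u x * u' x -
        2 * burgers_coeff 0 x * deriv (burgers_coeff 0) x) / (2 * \<epsilon>)) (at x within {0..2*pi})"
      by (simp only: u'_def[abs_def])
    then show ?thesis
      using e by (simp add: u''_def burgers_f_eq diff_divide_distrib del: burgers_coeff.simps)
  qed
  have "continuous_on {0..2*pi} u''"
    unfolding u''_def burgers_f_def
    by (intro continuous_intros DERIV_continuous_on[OF du] DERIV_continuous_on[OF du'])
       (use e in auto)
  then show ?thesis
    unfolding periodic_burgers_solution_def using du du' per e
    by (intro exI[of _ u'] exI[of _ u'']) (auto simp: u''_def)
qed

section \<open>Correction of the partial sum to an exact solution\<close>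

theorem theorem1p4:
  fixes n :: nat
  assumes "n \<ge> 1"
  shows "\<exists>\<epsilon>\<^sub>0>0. \<exists>C>0. \<forall>\<epsilon>. 0 < \<epsilon> \<and> \<epsilon> < \<epsilon>\<^sub>0 \<longrightarrow>
    (\<exists>u. periodic_burgers_solution \<epsilon> u \<and>
      (SUP x\<in>{0..2*pi}. \<bar>u x - (\<Sum>k\<le>n. \<epsilon> ^ k * burgers_coeff k x)\<bar>) \<le> C * \<epsilon> ^ (n + 1))"
proof -
  obtain K where K: "K > 0"
    "\<And>\<epsilon> x. 0 < \<epsilon> \<Longrightarrow> \<epsilon> < 1 \<Longrightarrow> \<bar>burgers_residual n \<epsilon> x\<bar> \<le> K * \<epsilon> ^ (n + 1)"
    using burgers_residual_bound[of n] by blast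
  obtain \<epsilon>\<^sub>1 where e1: "\<epsilon>\<^sub>1 > 0"
    "\<And>\<epsilon> x. 0 < \<epsilon> \<Longrightarrow> \<epsilon> < \<epsilon>\<^sub>1 \<Longrightarrow> burgers_partial_sum n \<epsilon> x \<le> - 1 / 2"
    using burgers_partial_sum_le[of n] by blast
  \<comment> \<open>The three bounds serve the negativity of the partial sum, the residual estimate,
    and 2 K \<epsilon> \<le> 1/4.\<close>
  define \<epsilon>\<^sub>0 where "\<epsilon>\<^sub>0 = min \<epsilon>\<^sub>1 (min 1 (1 / (8 * K)))"
  have "\<epsilon>\<^sub>0 > 0" using e1 K by (simp add: \<epsilon>\<^sub>0_def)
  moreover have "\<exists>u. periodic_burgers_solution \<epsilon> u \<and>
      (SUP x\<in>{0..2*pi}. \<bar>u x - burgers_partial_sum n \<epsilon> x\<bar>) \<le> 2 * K * \<epsilon> ^ (n + 1)"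
    if e: "0 < \<epsilon>" "\<epsilon> < \<epsilon>\<^sub>0" for \<epsilon>
  proof -
    define v where "v = burgers_partial_sum n \<epsilon>"
    define v' where "v' = burgers_partial_sum_deriv n \<epsilon>"
    have e': "\<epsilon> < \<epsilon>\<^sub>1" "\<epsilon> < 1" "\<epsilon> < 1 / (8 * K)" using e(2) by (auto simp: \<epsilon>\<^sub>0_def)
    have dv: "(v has_real_derivative v' x) (at x within A)" for x A
      unfolding v_def v'_def
      by (rule has_field_derivative_at_within[OF burgers_partial_sum_has_deriv])
    have cv: "continuous_on A v" for A by (rule DERIV_continuous_on[OF dv])
    have cv': "continuous_on A v'" for A
      unfolding v'_def by (rule continuous_on_burgers_partial_sum_deriv)
    have c0: "continuous_on A (burgers_coeff 0)" for A
      by (auto intro!: continuous_intros)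
    \<comment> \<open>Twice the residual bound: after division by 2 \<epsilon> the residual is then
      at most m \<delta>/2 with m = 1/(2 \<epsilon>).\<close>
    define \<delta> where "\<delta> = 2 * K * \<epsilon> ^ (n + 1)"
    have \<delta>: "\<delta> \<ge> 0" "\<delta> \<le> 1 / 4"
    proof -
      show "\<delta> \<ge> 0" using K e by (simp add: \<delta>_def)
      have "\<epsilon> ^ (n + 1) \<le> \<epsilon>" using e e' power_decreasing[of 1 "n + 1" \<epsilon>] by simp
      then have "\<delta> \<le> 2 * K * \<epsilon>" unfolding \<delta>_def using K by (intro mult_left_mono) auto
      also have "\<dots> \<le> 1 / 4" using e'(3) K by (simp add: field_simps)
      finally show "\<delta> \<le> 1 / 4" .
    qed
    \<comment> \<open>Inserting u = v + w into 2 \<epsilon> u' = u^2 - u_0^2 gives 2 \<epsilon> w' =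
      residual + 2 v w + w^2. After division by 2 \<epsilon> the damping is -v/\<epsilon> \<ge> 1/(2
      \<epsilon>) and the quadratic coefficient is 1/(2 \<epsilon>) as well, so the smallness
      condition reduces to \<delta> \<le> 1/4.\<close>
    have "\<exists>w. w 0 = w (2 * pi) \<and> (\<forall>x\<in>{0..2*pi}. \<bar>w x\<bar> \<le> \<delta>) \<and>
      (\<forall>x\<in>{0..2*pi}. (w has_real_derivative burgers_residual n \<epsilon> x / (2 * \<epsilon>)
        + 1 / (2 * \<epsilon>) * (w x)\<^sup>2 - (- v x / \<epsilon>) * w x) (at x within {0..2*pi}))"
    proof (rule periodic_riccati_exists[where m = "1 / (2 * \<epsilon>)"])
      show "continuous_on {0..2*pi} (\<lambda>x. - v x / \<epsilon>)"
        by (intro continuous_intros cv) (use e in auto)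
      show "continuous_on {0..2*pi} (\<lambda>x. burgers_residual n \<epsilon> x / (2 * \<epsilon>))"
        unfolding burgers_residual_def v_def[symmetric] v'_def[symmetric]
        by (intro continuous_intros cv cv' c0) (use e in auto)
      show "1 / (2 * \<epsilon>) \<le> - v x / \<epsilon>" for x
        using e1(2)[OF e(1) e'(1), of x] e by (simp add: v_def field_simps)
      show "1 / (2 * \<epsilon>) * \<delta> \<le> 1 / (2 * \<epsilon>) / 4"
        using mult_left_mono[OF \<delta>(2), of "1 / (2 * \<epsilon>)"] e by simp
      show "\<bar>burgers_residual n \<epsilon> x / (2 * \<epsilon>)\<bar> \<le> 1 / (2 * \<epsilon>) * \<delta> / 2" for x
      proof -
        have "\<bar>burgers_residual n \<epsilon> x\<bar> \<le> \<delta> / 2"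
          using K(2)[OF e(1) e'(2), of x] by (simp add: \<delta>_def)
        from divide_right_mono[OF this, of "2 * \<epsilon>"] show ?thesis using e by (simp add: abs_divide)
      qed
    qed (use e \<delta> in auto)
    then obtain w where w: "w 0 = w (2 * pi)" "\<And>x. x \<in> {0..2*pi} \<Longrightarrow> \<bar>w x\<bar> \<le> \<delta>"
      "\<And>x. x \<in> {0..2*pi} \<Longrightarrow> (w has_real_derivative burgers_residual n \<epsilon> x / (2 * \<epsilon>)
        + 1 / (2 * \<epsilon>) * (w x)\<^sup>2 - (- v x / \<epsilon>) * w x) (at x within {0..2*pi})"
      by blast
    define u where "u x = v x + w x" for x
    have "periodic_burgers_solution \<epsilon> u"
    proof (rule periodic_burgers_solutionI)
      have "v 0 = v (2 * pi)"
        unfolding v_def burgers_partial_sum_def using burgers_coeff_periodic[of _ 0] by simp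
      then show "u 0 = u (2 * pi)" using w(1) by (simp add: u_def)
      fix x assume x: "x \<in> {0..2*pi}"
      \<comment> \<open>The residual contributes -v', which cancels, and its v^2 joins 2 v w + w^2
        to form u^2.\<close>
      have "v' x + (burgers_residual n \<epsilon> x / (2 * \<epsilon>) + 1 / (2 * \<epsilon>) * (w x)\<^sup>2 - (- v x / \<epsilon>) * w x) =
          ((u x)\<^sup>2 - (burgers_coeff 0 x)\<^sup>2) / (2 * \<epsilon>)"
        using e unfolding burgers_residual_def v_def[symmetric] v'_def[symmetric] u_def
        by (simp add: divide_simps del: burgers_coeff.simps)
           (simp add: algebra_simps power2_eq_square del: burgers_coeff.simps)
      then show "(u has_real_derivative ((u x)\<^sup>2 - (burgers_coeff 0 x)\<^sup>2) / (2 * \<epsilon>))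
          (at x within {0..2*pi})"
        using DERIV_add[OF dv[of x] w(3)[OF x]] by (simp only: u_def[abs_def])
    qed (use e in auto)
    moreover have "(SUP x\<in>{0..2*pi}. \<bar>u x - v x\<bar>) \<le> \<delta>"
      by (rule cSUP_least) (use w(2) in \<open>auto simp: u_def\<close>)
    ultimately show ?thesis by (auto simp: v_def \<delta>_def)
  qed
  ultimately show ?thesis
    using K(1) unfolding burgers_partial_sum_def
    by (intro exI[of _ \<epsilon>\<^sub>0] conjI exI[of _ "2 * K"]) auto
qed

end
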